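(* For any graph $G$ of order $n$ with maximum degree $\Delta$, $\gamma^{NN}_{s}(G)\ge -n+2\left\lceil\frac{\Delta+1}{2}\right\rceil$. In particular, for a tree $T$ of order $n$ with maximum degree $\Delta$, equality $\gamma^{NN}_{s}(T)= -n+2\lceil\frac{\Delta+1}{2}\rceil$ holds if and only if $T\in\Theta$.
   Context: All graphs are finite and simple. For a vertex $v$, $N[v]=N(v)\cup\{v\}$; for $f:V(G)\to\mathbb{R}$ and $S\subseteq V(G)$, $f(S)=\sum_{v\in S}f(v)$. A nonnegative signed dominating function (NNSDF) of $G$ is a function $f:V(G)\to\{-1,1\}$ with $f(N[v])\ge 0$ for every $v\in V(G)$; $\gamma^{NN}_s(G)$ is the minimum of $f(V(G))$ over all NNSDFs $f$ of $G$. $\Theta$ is the collection of all trees $T$ with maximum degree $\Delta=\Delta(T)$ obtained as follows: $T$ contains a vertex $u$ of degree $\Delta$ (so $T$ contains the star $K_{1,\Delta}$ on $N[u]$ with center $u$), every vertex of $V(T)\setminus N[u]$ is a leaf whose (unique) neighbor lies in a set $S\subseteq N(u)$ with $|S|=\lfloor\frac{\Delta}{2}\rfloor$, and $\deg(s)\le 3$ for all $s\in S$. *)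

theory Defs
  imports Complex_Main "Graph_Theory.Digraph_Component"
begin

text \<open>
  Finite simple graphs are the locale \<open>graph\<close> of the AFP entry Graph_Theory: finite, loop-free,
  symmetric digraphs without parallel arcs, an edge \<open>vw\<close> being the two arcs from \<open>v\<close> to \<open>w\<close>
  and from \<open>w\<close> to \<open>v\<close>.
\<close>

definition nbhd :: "('a, 'b) pre_digraph \<Rightarrow> 'a \<Rightarrow> 'a set" where
  "nbhd G v = {w. v \<rightarrow>\<^bsub>G\<^esub> w}"

definition closed_nbhd :: "('a, 'b) pre_digraph \<Rightarrow> 'a \<Rightarrow> 'a set" where
  "closed_nbhd G v = insert v (nbhd G v)"

definition deg :: "('a, 'b) pre_digraph \<Rightarrow> 'a \<Rightarrow> nat" where
  "deg G v = card (nbhd G v)"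

definition max_deg :: "('a, 'b) pre_digraph \<Rightarrow> nat" where
  "max_deg G = Max (deg G ` verts G)"

text \<open>
  The predicate \<open>tree\<close> of Graph_Theory is unsuitable for graphs seen as symmetric digraphs: it
  counts the walk \<open>v, w, v\<close> along a single edge as a cycle. A cycle of an undirected graph has
  at least three edges.
\<close>

definition undirected_tree :: "('a, 'b) pre_digraph \<Rightarrow> bool" where
  "undirected_tree G \<longleftrightarrow> connected G \<and> \<not> (\<exists>p. pre_digraph.cycle G p \<and> length p \<ge> 3)"

definition nnsdf :: "('a, 'b) pre_digraph \<Rightarrow> ('a \<Rightarrow> int) \<Rightarrow> bool" where
  "nnsdf G f \<longleftrightarrow> f ` verts G \<subseteq> {-1, 1} \<and> (\<forall>v\<in>verts G. sum f (closed_nbhd G v) \<ge> 0)"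

definition nnsd_number :: "('a, 'b) pre_digraph \<Rightarrow> int" where
  "nnsd_number G = Min {sum f (verts G) | f. nnsdf G f}"

definition Theta :: "('a, 'b) pre_digraph set" where
  "Theta = {T. graph T \<and> undirected_tree T \<and>
     (\<exists>u\<in>verts T. deg T u = max_deg T \<and>
       (\<exists>S \<subseteq> nbhd T u. card S = max_deg T div 2 \<and>
         (\<forall>v \<in> verts T - closed_nbhd T u. deg T v = 1 \<and> nbhd T v \<subseteq> S) \<and>
         (\<forall>s\<in>S. deg T s \<le> 3)))}"

text \<open>The minimum defining \<open>nnsd_number\<close> is over a finite nonempty set.\<close>

lemma finite_nnsdf_weights: "finite {sum f (verts G) | f. nnsdf G f}"
proof -
  have "\<bar>sum f (verts G)\<bar> \<le> int (card (verts G))" if "nnsdf G f" for f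
  proof -
    have "\<bar>sum f (verts G)\<bar> \<le> (\<Sum>v\<in>verts G. \<bar>f v\<bar>)" by (rule sum_abs)
    also have "\<dots> \<le> (\<Sum>v\<in>verts G. 1)"
      using that by (intro sum_mono) (auto simp: nnsdf_def image_subset_iff)
    finally show ?thesis by simp
  qed
  then have "{sum f (verts G) | f. nnsdf G f} \<subseteq> {- int (card (verts G)) .. int (card (verts G))}"
    by (fastforce simp: abs_le_iff)
  then show ?thesis by (rule finite_subset) simp
qed

lemma nnsdf_weights_nonempty: "{sum f (verts G) | f. nnsdf G f} \<noteq> {}"
proof -
  have "nnsdf G (\<lambda>_. 1)" by (auto simp: nnsdf_def)
  then show ?thesis by blast
qed

end

theory Submission
  imports Defs
begin

text \<open>
  Let \<open>P\<close> be the set of vertices of value \<open>1\<close>, so that \<open>f\<close> has weight \<open>2 |P| - n\<close>. Nonnegativity on \<open>N[u]\<close>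
  with \<open>u\<close> of degree \<open>\<Delta>\<close> gives \<open>|P \<inter> N[u]| \<ge> \<lfloor>\<Delta>/2\<rfloor> + 1\<close>, which is the bound, and equality forces
  \<open>P \<subseteq> N[u]\<close>. In a tree every vertex other than \<open>u\<close> has at most one neighbour in \<open>N(u)\<close>, and
  neighbours of \<open>u\<close> have none, so in the case of equality each vertex sees very few positive values.
  If \<open>u \<in> P\<close>, this makes \<open>S = P - {u}\<close> a witness for \<open>\<Theta>\<close>. If \<open>u \<notin> P\<close>, it leaves no vertex outside
  \<open>N[u]\<close>, and any \<open>S\<close> of the right size works.
\<close>

section \<open>Sums of signs and rounding\<close>

lemma sum_signs:
  fixes f :: "'a \<Rightarrow> int"
  assumes "finite A" and "f ` A \<subseteq> {-1, 1}"
  shows "sum f A = 2 * int (card {x \<in> A. f x = 1}) - int (card A)"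
proof -
  have "f x = 2 * (if f x = 1 then 1 else 0) - 1" if "x \<in> A" for x
    using assms(2) that by auto
  then have "sum f A = (\<Sum>x\<in>A. 2 * (if f x = 1 then 1 else 0) - 1)"
    by (intro sum.cong) auto
  also have "\<dots> = 2 * (\<Sum>x\<in>A. if f x = 1 then 1 else 0) - int (card A)"
    by (simp add: sum_subtractf sum_distrib_left)
  also have "(\<Sum>x\<in>A. if f x = 1 then 1 else 0) = int (card {x \<in> A. f x = 1})"
    using assms(1) by (simp add: sum.If_cases Int_def)
  finally show ?thesis .
qed

text \<open>Bridges the ceiling of the theorem and natural-number division, in which all counting
  below is done. Writing d as twice \<open>d div 2\<close> plus a remainder in {0, 1} treats both
  parities at once.\<close>

lemma ceiling_half_Suc: "\<lceil>(real d + 1) / 2\<rceil> = int (d div 2) + 1"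
proof (rule ceiling_unique)
  have d: "real d = 2 * real (d div 2) + real (d mod 2)"
    by (metis mult_div_mod_eq of_nat_add of_nat_mult of_nat_numeral)
  have m: "real (d mod 2) \<ge> 0" "real (d mod 2) \<le> 1"
    using mod_less_divisor[of 2 d] by auto
  show "of_int (int (d div 2) + 1) - 1 < (real d + 1) / 2" using d m by simp
  show "(real d + 1) / 2 \<le> of_int (int (d div 2) + 1)" using d m by simp
qed

section \<open>Short cycles in trees\<close>

lemma mem_nbhd: "w \<in> nbhd G v \<longleftrightarrow> v \<rightarrow>\<^bsub>G\<^esub> w"
  by (simp add: nbhd_def)

text \<open>The three arcs form a closed walk with distinct vertices, a \<open>cycle\<close> whose
  length just reaches the threshold 3 in \<open>undirected_tree\<close>.\<close>

lemma (in wf_digraph) undirected_tree_no_triangle: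
  assumes "undirected_tree G" "a \<rightarrow> b" "b \<rightarrow> c" "c \<rightarrow> a" "distinct [a, b, c]"
  shows False
proof -
  obtain e1 e2 e3 where
    "e1 \<in> arcs G" "tail G e1 = a" "head G e1 = b"
    "e2 \<in> arcs G" "tail G e2 = b" "head G e2 = c"
    "e3 \<in> arcs G" "tail G e3 = c" "head G e3 = a"
    using assms(2-4) by (meson reachableE)
  then have "cycle [e1, e2, e3]"
    using assms(5) by (auto simp: cycle_def awalk_Cons_iff awalk_Nil_iff intro!: exI[of _ a])
  then have "\<exists>p. cycle p \<and> length p \<ge> 3"
    by (intro exI[of _ "[e1, e2, e3]"]) simp
  then show False
    using assms(1) unfolding undirected_tree_def by blast
qed

lemma (in wf_digraph) undirected_tree_no_square:
  assumes "undirected_tree G" "a \<rightarrow> b" "b \<rightarrow> c" "c \<rightarrow> d" "d \<rightarrow> a" "distinct [a, b, c, d]"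
  shows False
proof -
  obtain e1 e2 e3 e4 where
    "e1 \<in> arcs G" "tail G e1 = a" "head G e1 = b"
    "e2 \<in> arcs G" "tail G e2 = b" "head G e2 = c"
    "e3 \<in> arcs G" "tail G e3 = c" "head G e3 = d"
    "e4 \<in> arcs G" "tail G e4 = d" "head G e4 = a"
    using assms(2-5) by (meson reachableE)
  then have "cycle [e1, e2, e3, e4]"
    using assms(6) by (auto simp: cycle_def awalk_Cons_iff awalk_Nil_iff intro!: exI[of _ a])
  then have "\<exists>p. cycle p \<and> length p \<ge> 3"
    by (intro exI[of _ "[e1, e2, e3, e4]"]) simp
  then show False
    using assms(1) unfolding undirected_tree_def by blast
qed

section \<open>Positive vertices in closed neighbourhoods and the lower bound\<close>

context graph
begin

lemma adj_sym: "v \<rightarrow> w \<Longrightarrow> w \<rightarrow> v"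
  using arcs_ends_symmetric[OF sym_arcs] .

lemma closed_nbhd_subset: "v \<in> verts G \<Longrightarrow> closed_nbhd G v \<subseteq> verts G"
  by (auto simp: closed_nbhd_def mem_nbhd adj_in_verts)

lemma finite_nbhd: "finite (nbhd G v)"
  by (rule finite_subset[of _ "verts G"]) (auto simp: mem_nbhd adj_in_verts)

lemma not_mem_nbhd_self: "v \<notin> nbhd G v"
  by (auto simp: mem_nbhd dest: adj_not_same)

lemma card_closed_nbhd: "card (closed_nbhd G v) = Suc (deg G v)"
  unfolding closed_nbhd_def deg_def 
  by (simp add: finite_nbhd not_mem_nbhd_self)

text \<open>A closed neighbourhood carries deg + 1 signs; if p of them are 1, their sum is 2p - (deg
  + 1), so nonnegativity becomes an inequality between natural numbers.\<close>

lemma nnsdf_deg_le: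
  assumes "nnsdf G f" "v \<in> verts G"
  shows "Suc (deg G v) \<le> 2 * card {x \<in> closed_nbhd G v. f x = 1}"
proof -
  have "f ` closed_nbhd G v \<subseteq> {-1, 1}"
    using assms closed_nbhd_subset[OF assms(2)] by (auto simp: nnsdf_def)
  moreover have "finite (closed_nbhd G v)"
    using finite_nbhd by (simp add: closed_nbhd_def)
  ultimately have "sum f (closed_nbhd G v)
      = 2 * int (card {x \<in> closed_nbhd G v. f x = 1}) - int (Suc (deg G v))"
    by (simp add: sum_signs card_closed_nbhd)
  then show ?thesis
    using assms by (auto simp: nnsdf_def)
qed

lemma nnsdf_weight:
  assumes "nnsdf G f"
  shows "sum f (verts G) = 2 * int (card {x \<in> verts G. f x = 1}) - int (card (verts G))"
  using assms by (intro sum_signs) (auto simp: nnsdf_def)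

lemma nnsd_number_attained: "\<exists>f. nnsdf G f \<and> nnsd_number G = sum f (verts G)"
  using Min_in[OF finite_nnsdf_weights[of G] nnsdf_weights_nonempty[of G]]
  unfolding nnsd_number_def by blast

lemma nnsd_number_le: "nnsdf G f \<Longrightarrow> nnsd_number G \<le> sum f (verts G)"
  unfolding nnsd_number_def by (intro Min_le finite_nnsdf_weights) blast

lemma max_deg_attained: "verts G \<noteq> {} \<Longrightarrow> \<exists>u\<in>verts G. deg G u = max_deg G"
  using Max_in[of "deg G ` verts G"] unfolding max_deg_def by fastforce

lemma nnsdf_card_pos_closed_nbhd:
  assumes "nnsdf G f" "u \<in> verts G"
  shows "deg G u div 2 + 1 \<le> card {x \<in> closed_nbhd G u. f x = 1}"
  using nnsdf_deg_le[OF assms] by linarith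

lemma nnsd_number_ge:
  assumes "verts G \<noteq> {}"
  shows "nnsd_number G \<ge> 2 * (int (max_deg G div 2) + 1) - int (card (verts G))"
proof -
  obtain f where f: "nnsdf G f" "nnsd_number G = sum f (verts G)"
    using nnsd_number_attained by blast
  obtain u where u: "u \<in> verts G" "deg G u = max_deg G"
    using max_deg_attained[OF assms] by blast
  have "card {x \<in> closed_nbhd G u. f x = 1} \<le> card {x \<in> verts G. f x = 1}"
    using closed_nbhd_subset[OF u(1)] by (intro card_mono) auto
  then show ?thesis
    using nnsdf_card_pos_closed_nbhd[OF f(1) u(1)] nnsdf_weight[OF f(1)] f(2) u(2) by simp
qed

section \<open>Neighbourhoods in a tree\<close>

lemma tree_nbhd_disjoint:
  assumes "undirected_tree G" "u \<rightarrow> a"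
  shows "nbhd G a \<inter> nbhd G u = {}"
proof -
  \<comment> \<open>A common neighbour \<open>b\<close> of the adjacent \<open>u\<close> and
    \<open>a\<close> would close a triangle. Hence neighbourhoods in a tree are independent
    sets.\<close>
  have False if "a \<rightarrow> b" "u \<rightarrow> b" for b
  proof -
    have "distinct [u, a, b]" using assms that by (auto dest: adj_not_same)
    then show False
      using undirected_tree_no_triangle[OF assms that(1)] adj_sym[OF that(2)] by blast
  qed
  then show ?thesis by (auto simp: mem_nbhd)
qed

text \<open>Otherwise u, a, v, b would be a 4-cycle. With \<open>u\<close> as center, a vertex
  outside N[u] sees at most one vertex of N(u).\<close>

lemma tree_common_nbhd:
  assumes "undirected_tree G" "u \<noteq> v" "a \<in> nbhd G u \<inter> nbhd G v" "b \<in> nbhd G u \<inter> nbhd G v"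
  shows "a = b"
proof (rule ccontr)
  assume "a \<noteq> b"
  have e: "u \<rightarrow> a" "v \<rightarrow> a" "u \<rightarrow> b" "v \<rightarrow> b" using assms by (auto simp: mem_nbhd)
  then have "distinct [u, a, v, b]"
    using \<open>a \<noteq> b\<close> assms(2) by (auto dest: adj_not_same)
  then show False
    using undirected_tree_no_square[OF assms(1) e(1) adj_sym[OF e(2)] e(4) adj_sym[OF e(3)]] by blast
qed

section \<open>Trees in Theta attain the bound\<close>

lemma Theta_nnsdf:
  assumes tree: "undirected_tree G" and u: "u \<in> verts G" "deg G u = d"
    and S: "S \<subseteq> nbhd G u" "card S = d div 2"
    and out: "\<And>v. v \<in> verts G - closed_nbhd G u \<Longrightarrow> deg G v = 1 \<and> nbhd G v \<subseteq> S"
    and deg3: "\<And>s. s \<in> S \<Longrightarrow> deg G s \<le> 3"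
  defines "f \<equiv> \<lambda>x. if x \<in> insert u S then 1 else (-1::int)"
  shows "nnsdf G f"
proof -
  have "sum f (closed_nbhd G v) \<ge> 0" if v: "v \<in> verts G" for v
  proof -
    let ?P = "{x \<in> closed_nbhd G v. f x = 1}"
    have P: "?P = closed_nbhd G v \<inter> insert u S" by (auto simp: f_def)
    have finN: "finite (closed_nbhd G v)" using finite_nbhd by (simp add: closed_nbhd_def)
    have lb: "card A \<le> card ?P" if "A \<subseteq> closed_nbhd G v \<inter> insert u S" for A
      unfolding P using that finN by (intro card_mono) auto
    have "Suc (deg G v) \<le> 2 * card ?P"
    proof -
      \<comment> \<open>N[u] has d + 1 vertices, of which \<open>u\<close> and all of
        \<open>S\<close> are positive. For \<open>v\<close> in \<open>S\<close>, both
        \<open>v\<close> and \<open>u\<close> are positive among at most four vertices. In the last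
        two cases N[v] has at most two vertices, one of them positive: \<open>u\<close>, or the
        neighbour in \<open>S\<close>.\<close>
      consider "v = u" | "v \<in> S" | "v \<in> nbhd G u - S" | "v \<in> verts G - closed_nbhd G u"
        using v by (auto simp: closed_nbhd_def)
      then show ?thesis
      proof cases
        case 1
        have "card (insert u S) = Suc (card S)"
          using finite_subset[OF S(1) finite_nbhd] not_mem_nbhd_self S(1)
          by (intro card_insert_disjoint) auto
        moreover have "insert u S \<subseteq> closed_nbhd G v \<inter> insert u S"
          using 1 S(1) by (auto simp: closed_nbhd_def)
        ultimately have "Suc (d div 2) \<le> card ?P" using lb S(2) by metis
        moreover have "deg G v = d" using 1 u(2) by simp
        ultimately show ?thesis by linarith
      next
        case 2
        then have "u \<rightarrow> v" using S(1) by (auto simp: mem_nbhd)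
        then have "u \<in> nbhd G v" "u \<noteq> v" by (auto simp: mem_nbhd dest: adj_sym adj_not_same)
        then have "card {u, v} \<le> card ?P" using 2 by (intro lb) (auto simp: closed_nbhd_def)
        then show ?thesis using deg3[OF 2] \<open>u \<noteq> v\<close> by simp
      next
        case 3
        then have uv: "u \<rightarrow> v" by (simp add: mem_nbhd)
        \<comment> \<open>A neighbour \<open>x\<close> outside N[u] would be adjacent to
          \<open>S\<close> only, but \<open>v\<close> is not in \<open>S\<close>; a neighbour in
          N(u) would give a triangle.\<close>
        have "nbhd G v \<subseteq> {u}"
        proof
          fix x assume x: "x \<in> nbhd G v"
          then have "v \<in> nbhd G x" "x \<in> verts G" by (auto simp: mem_nbhd dest: adj_sym adj_in_verts)
          then have "x \<in> closed_nbhd G u" using out[of x] 3 by blast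
          then show "x \<in> {u}" using x tree_nbhd_disjoint[OF tree uv] by (auto simp: closed_nbhd_def)
        qed
        then have "deg G v \<le> 1" unfolding deg_def using card_mono[of "{u}"] by fastforce
        moreover have "card {u} \<le> card ?P"
          using adj_sym[OF uv] by (intro lb) (auto simp: closed_nbhd_def mem_nbhd)
        ultimately show ?thesis by simp
      next
        case 4
        then have "deg G v = 1" "nbhd G v \<subseteq> S" using out by auto
        moreover from this(1) obtain a where "a \<in> nbhd G v" unfolding deg_def by fastforce
        ultimately have "card {a} \<le> card ?P" by (intro lb) (auto simp: closed_nbhd_def)
        then show ?thesis using \<open>deg G v = 1\<close> by simp
      qed
    qed
    moreover have "f ` closed_nbhd G v \<subseteq> {-1, 1}" by (auto simp: f_def)
    ultimately show ?thesis using sum_signs[OF finN] card_closed_nbhd[of v] by simp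
  qed
  then show ?thesis by (auto simp: nnsdf_def f_def)
qed

text \<open>The function that is 1 exactly on \<open>u\<close> and \<open>S\<close> has
  \<open>max_deg G div 2 + 1\<close> positive vertices, so its weight meets the lower bound.\<close>

lemma Theta_imp_nnsd_number:
  assumes "G \<in> Theta"
  shows "nnsd_number G = 2 * (int (max_deg G div 2) + 1) - int (card (verts G))"
proof -
  obtain u S where tree: "undirected_tree G" and u: "u \<in> verts G" "deg G u = max_deg G"
    and S: "S \<subseteq> nbhd G u" "card S = max_deg G div 2"
    and out: "\<forall>v \<in> verts G - closed_nbhd G u. deg G v = 1 \<and> nbhd G v \<subseteq> S"
    and deg3: "\<forall>s\<in>S. deg G s \<le> 3"
    using assms unfolding Theta_def by auto
  define f where "f x = (if x \<in> insert u S then 1 else (-1::int))" for x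
  have f: "nnsdf G f"
    unfolding f_def using out deg3 by (intro Theta_nnsdf[OF tree u S]) auto
  have "{x \<in> verts G. f x = 1} = insert u S"
    using u(1) S(1) by (auto simp: f_def mem_nbhd adj_in_verts)
  moreover have "card (insert u S) = Suc (card S)"
    using finite_subset[OF S(1) finite_nbhd] not_mem_nbhd_self S(1)
    by (intro card_insert_disjoint) auto
  ultimately have "nnsd_number G \<le> 2 * (int (max_deg G div 2) + 1) - int (card (verts G))"
    using nnsd_number_le[OF f] nnsdf_weight[OF f] S(2) by simp
  then show ?thesis using nnsd_number_ge u(1) by fastforce
qed

section \<open>Extremal trees belong to Theta\<close>

lemma tree_nnsd_number_imp_Theta:
  assumes tree: "undirected_tree G" and ne: "verts G \<noteq> {}"
    and eq: "nnsd_number G = 2 * (int (max_deg G div 2) + 1) - int (card (verts G))"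
  shows "G \<in> Theta"
proof -
  obtain f where f: "nnsdf G f" "nnsd_number G = sum f (verts G)"
    using nnsd_number_attained by blast
  obtain u where u: "u \<in> verts G" "deg G u = max_deg G"
    using max_deg_attained[OF ne] by blast
  define P where "P = {x \<in> verts G. f x = 1}"
  have finP: "finite P" by (simp add: P_def)
  have cardP: "card P = max_deg G div 2 + 1"
    using nnsdf_weight[OF f(1)] f(2) eq by (simp add: P_def)
  have pos: "{x \<in> closed_nbhd G v. f x = 1} = closed_nbhd G v \<inter> P" if "v \<in> verts G" for v
    using closed_nbhd_subset[OF that] by (auto simp: P_def)
  have degP: "Suc (deg G v) \<le> 2 * card (closed_nbhd G v \<inter> P)" if "v \<in> verts G" for v
    using nnsdf_deg_le[OF f(1) that] pos[OF that] by simp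
  \<comment> \<open>N[u] alone must contain as many positive vertices as there are in all of
    \<open>P\<close>.\<close>
  have "closed_nbhd G u \<inter> P = P"
    using nnsdf_card_pos_closed_nbhd[OF f(1) u(1)] cardP u(2) finP
    by (intro card_seteq) (auto simp: pos[OF u(1)])
  then have PN: "P \<subseteq> insert u (nbhd G u)" by (auto simp: closed_nbhd_def)
  have nbr: "nbhd G a \<inter> P \<subseteq> {u}" if "u \<rightarrow> a" for a
    using tree_nbhd_disjoint[OF tree that] PN by blast
  \<comment> \<open>Since \<open>v\<close> is negative, the positive vertices of N[v] are common
    neighbours of \<open>u\<close> and \<open>v\<close>, so there is at most one. Nonnegativity
    demands one and then bounds the degree of \<open>v\<close> by 1.\<close>
  have out: "\<exists>a. a \<in> P \<and> u \<rightarrow> a \<and> nbhd G v = {a}" if v: "v \<in> verts G - closed_nbhd G u" for v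
  proof -
    have v': "v \<in> verts G" "u \<noteq> v" "u \<notin> nbhd G v" "v \<notin> P"
      using v PN by (auto simp: closed_nbhd_def mem_nbhd dest: adj_sym)
    then have sub: "closed_nbhd G v \<inter> P \<subseteq> nbhd G u \<inter> nbhd G v"
      using PN by (auto simp: closed_nbhd_def)
    have "card (closed_nbhd G v \<inter> P) \<noteq> 0" using degP[OF v'(1)] by simp
    then obtain a where a: "a \<in> closed_nbhd G v \<inter> P" by (metis card.empty ex_in_conv)
    then have "closed_nbhd G v \<inter> P \<subseteq> {a}"
      using tree_common_nbhd[OF tree v'(2)] sub by blast
    then have "closed_nbhd G v \<inter> P = {a}" using a by blast
    then have "card (nbhd G v) \<le> card {a}" using degP[OF v'(1)] by (simp add: deg_def)
    then have "{a} = nbhd G v" using a sub finite_nbhd by (intro card_seteq) auto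
    moreover have "a \<in> P" "u \<rightarrow> a" using a sub by (auto simp flip: mem_nbhd)
    ultimately show ?thesis by blast
  qed
  have "\<exists>S \<subseteq> nbhd G u. card S = max_deg G div 2 \<and>
         (\<forall>v \<in> verts G - closed_nbhd G u. deg G v = 1 \<and> nbhd G v \<subseteq> S) \<and>
         (\<forall>s\<in>S. deg G s \<le> 3)"
  proof (cases "u \<in> P")
    case True
    \<comment> \<open>Only \<open>s\<close> and \<open>u\<close> can be positive in N[s], so N[s]
      has at most four vertices.\<close>
    have "deg G s \<le> 3" if "s \<in> P - {u}" for s
    proof -
      have us: "u \<rightarrow> s" using that PN by (auto simp: mem_nbhd)
      then have "closed_nbhd G s \<inter> P \<subseteq> {s, u}" using nbr[OF us] by (auto simp: closed_nbhd_def)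
      then have "card (closed_nbhd G s \<inter> P) \<le> card {s, u}" by (intro card_mono) auto
      also have "\<dots> \<le> 2" using card_insert_le_m1[of 2 "{u}" s] by simp
      finally show ?thesis using degP[of s] us by (auto dest: adj_in_verts)
    qed
    moreover have "deg G v = 1 \<and> nbhd G v \<subseteq> P - {u}" if "v \<in> verts G - closed_nbhd G u" for v
      using out[OF that] by (auto simp: deg_def dest: adj_not_same)
    moreover have "card (P - {u}) = max_deg G div 2" "P - {u} \<subseteq> nbhd G u"
      using True cardP finP PN by auto
    ultimately show ?thesis by (intro exI[of _ "P - {u}"]) auto
  next
    case False
    \<comment> \<open>With \<open>u\<close> negative, only \<open>a\<close> itself can be positive
      in N[a].\<close>
    have nbr1: "deg G a \<le> 1" if "u \<rightarrow> a" for a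
    proof -
      have "closed_nbhd G a \<inter> P \<subseteq> {a}" using nbr[OF that] False by (auto simp: closed_nbhd_def)
      then have "card (closed_nbhd G a \<inter> P) \<le> card {a}" by (intro card_mono) auto
      then show ?thesis using degP[of a] that by (auto dest: adj_in_verts)
    qed
    have "verts G - closed_nbhd G u = {}"
    \<comment> \<open>The neighbour \<open>a\<close> of an outer vertex \<open>v\<close> would be
      adjacent to both \<open>u\<close> and \<open>v\<close>, against \<open>nbr1\<close>.\<close>
    proof (rule equals0I)
      fix v assume v: "v \<in> verts G - closed_nbhd G u"
      then obtain a where a: "u \<rightarrow> a" "nbhd G v = {a}" using out by blast
      then have "v \<rightarrow> a" by (auto simp flip: mem_nbhd)
      then have "{u, v} \<subseteq> nbhd G a" using a(1) by (auto simp: mem_nbhd dest: adj_sym)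
      then have "card {u, v} \<le> deg G a" unfolding deg_def using finite_nbhd by (intro card_mono) auto
      moreover have "u \<noteq> v" using v by (auto simp: closed_nbhd_def)
      ultimately show False using nbr1[OF a(1)] by simp
    qed
    \<comment> \<open>The condition on outer vertices is now vacuous and \<open>nbr1\<close> gives
      the degree bound, so only the size of \<open>S\<close> matters.\<close>
    moreover obtain S where "S \<subseteq> nbhd G u" "card S = max_deg G div 2"
      using obtain_subset_with_card_n[of "max_deg G div 2" "nbhd G u"] u(2)
      by (auto simp: deg_def)
    moreover have "\<forall>s\<in>S. deg G s \<le> 3"
      using nbr1 \<open>S \<subseteq> nbhd G u\<close> by (fastforce simp: mem_nbhd)
    ultimately show ?thesis by blast
  qed
  then show ?thesis
    using tree u graph_axioms unfolding Theta_def by blast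
qed

end

theorem theorem4p2:
  fixes G :: "('a, 'b) pre_digraph"
  assumes "graph G" and "verts G \<noteq> {}"
  shows "nnsd_number G \<ge> - int (card (verts G)) + 2 * \<lceil>(real (max_deg G) + 1) / 2\<rceil> \<and>
    (undirected_tree G \<longrightarrow>
      (nnsd_number G = - int (card (verts G)) + 2 * \<lceil>(real (max_deg G) + 1) / 2\<rceil>
        \<longleftrightarrow> G \<in> Theta))"
proof -
  interpret graph G by fact
  show ?thesis
    using nnsd_number_ge[OF assms(2)] Theta_imp_nnsd_number tree_nnsd_number_imp_Theta[OF _ assms(2)]
    by (auto simp: ceiling_half_Suc)
qed

end
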